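(* Let $\mathcal{A}$ be a regular Baer *-ring ordered by $\preceq^{\alpha}$, where $\alpha$ is any of $r*|\ell\square$, $r*|r\square$, $r*|\square$, $*|\ell\square$, $*|r\square$, $*|\square$, $\ell*$, $\ell*|\ell\square$, $\ell*|r\square$, $\ell*|\square$. If $b\in\mathcal{A}$ is an upper bound (with respect to $\preceq^{\alpha}$) of a nonempty subset $B\subseteq\mathcal{A}$, then the least upper bound of $B$ and the greatest lower bound of $B$ exist in $(\mathcal{A},\preceq^{\alpha})$. Moreover, $$\bigvee\{c: c\in B\}=b\left(\bigvee\{\mathrm{rp}(c): c\in B\}\right)\quad\text{and}\quad\bigwedge\{c: c\in B\}=b\left(\bigwedge\{\mathrm{rp}(c): c\in B\}\right)$$ whenever $\alpha\in\{r*|\ell\square,\ r*|r\square,\ r*|\square,\ *|\ell\square,\ *|r\square,\ *|\square\}$, while $$\bigvee\{c: c\in B\}=\left(\bigvee\{\mathrm{lp}(c): c\in B\}\right)b\quad\text{and}\quad\bigwedge\{c: c\in B\}=\left(\bigwedge\{\mathrm{lp}(c): c\in B\}\right)b$$ whenever $\alpha\in\{\ell*,\ \ell*|\ell\square,\ \ell*|r\square,\ \ell*|\square\}$. (On the left-hand sides the bounds are taken in $(\mathcal{A},\preceq^{\alpha})$; on the right-hand sides in the complete lattice $E(\mathcal{A})$.)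
   Context: A *-ring is an (associative) ring $\mathcal{A}$ with an involution $*$: $(a+b)^*=a^*+b^*$, $(ab)^*=b^*a^*$, $(a^* )^*=a$. A Baer *-ring is a *-ring in which the right annihilator of every subset is a principal right ideal generated by a self-adjoint idempotent ($p=p^*=p^2$). Let $E(\mathcal{A})$ be the set of self-adjoint idempotents, partially ordered by $p\le q$ iff $p=pq$. A Baer *-ring has an identity $1$ and is a Rickart *-ring: for every $a$ there are unique self-adjoint idempotents $\mathrm{lp}(a)$, $\mathrm{rp}(a)$ with $\{x: xa=0\}=\mathcal{A}(1-\mathrm{lp}(a))$ and $\{x: ax=0\}=(1-\mathrm{rp}(a))\mathcal{A}$; moreover it is known that $E(\mathcal{A})$ is a complete lattice. The ring is regular if for every $a\in\mathcal{A}$ there is $a^-\in\mathcal{A}$ with $aa^-a=a$. Base relations: $a\preceq^{r*} b$ iff $a\,\mathrm{rp}(b)=a=b\,\mathrm{rp}(a)$; $a\preceq^{\ell*} b$ iff $\mathrm{lp}(a)b=a=\mathrm{lp}(b)a$; $a\preceq^{*} b$ iff $\mathrm{lp}(a)b=a=b\,\mathrm{rp}(a)$. For $\beta\in\{r*,\ell*,*\}$: $a\preceq^{\beta|\ell\square} b$ iff $a\preceq^{\beta}b$ and $a^2=ab$; $a\preceq^{\beta|r\square} b$ iff $a\preceq^{\beta}b$ and $a^2=ba$; $a\preceq^{\beta|\square} b$ iff $a\preceq^{\beta}b$ and $a^2=ab=ba$. All of these are partial orders on $\mathcal{A}$. *)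

theory Defs
  imports "HOL-Algebra.Complete_Lattice"
begin

text \<open>
  The class \<^class>\<open>ring\<close> is the class of associative rings, not assumed to have an identity.
\<close>

class star_ring = ring +
  fixes star :: "'a \<Rightarrow> 'a"
  assumes star_add: "star (a + b) = star a + star b"
    and star_mult: "star (a * b) = star b * star a"
    and star_star [simp]: "star (star a) = a"

definition projections :: "'a::star_ring set" where
  "projections = {p. p = star p \<and> p = p * p}"

class baer_star_ring = star_ring +
  assumes baer:
    "\<exists>p. p = star p \<and> p = p * p \<and> {x. \<forall>s\<in>S. s * x = 0} = range (\<lambda>x. p * x)"

class regular_baer_star_ring = baer_star_ring +
  assumes regular: "\<exists>x. a * x * a = a"

text \<open>
  A Baer *-ring automatically has an identity. It is introduced as a defined constant,
  so that neither its existence nor its being nonzero becomes an assumption.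
\<close>

definition ring_unit :: "'a::baer_star_ring" where
  "ring_unit = (THE e. \<forall>x. e * x = x \<and> x * e = x)"

lemma ring_unit_mult [simp]:
  fixes x :: "'a::baer_star_ring"
  shows "ring_unit * x = x" and "x * ring_unit = x"
proof -
  obtain e :: 'a where e: "e = star e" "e = e * e" "{x. \<forall>s\<in>{}. s * x = 0} = range (\<lambda>x. e * x)"
    using baer[of "{}"] by blast
  have l: "e * y = y" for y
  proof -
    have "y \<in> range (\<lambda>x. e * x)" using e(3) by auto
    then obtain z where "y = e * z" by blast
    then show ?thesis using e(2) by (metis mult.assoc)
  qed
  have r: "y * e = y" for y
    by (metis l e(1) star_mult star_star)
  have "\<exists>!e::'a. \<forall>x. e * x = x \<and> x * e = x"
    using l r by metis
  from theI'[OF this] show "ring_unit * x = x" and "x * ring_unit = x"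
    unfolding ring_unit_def by blast+
qed

definition rp :: "'a::baer_star_ring \<Rightarrow> 'a" where
  "rp a = (THE p. p \<in> projections \<and> {x. a * x = 0} = range (\<lambda>y. (ring_unit - p) * y))"

definition lp :: "'a::baer_star_ring \<Rightarrow> 'a" where
  "lp a = (THE p. p \<in> projections \<and> {x. x * a = 0} = range (\<lambda>y. y * (ring_unit - p)))"

lemma star_zero [simp]: "star 0 = (0::'a::star_ring)"
  using star_add[of 0 0] by simp

lemma star_diff: "star (a - b) = star a - star (b::'a::star_ring)"
  using star_add[of "a - b" b] by simp

lemma star_ring_unit [simp]: "star ring_unit = (ring_unit::'a::baer_star_ring)"
  by (metis ring_unit_mult star_mult star_star)

lemma compl_projections:
  "p \<in> projections \<Longrightarrow> ring_unit - p \<in> (projections :: 'a::baer_star_ring set)"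
  by (auto simp: projections_def star_diff left_diff_distrib right_diff_distrib)

lemma projections_eqI:
  fixes p q :: "'a::baer_star_ring"
  assumes "p \<in> projections" "q \<in> projections" "range (\<lambda>y. p * y) = range (\<lambda>y. q * y)"
  shows "p = q"
proof -
  have idem: "p * p = p" "q * q = q" and sa: "star p = p" "star q = q"
    using assms(1,2) unfolding projections_def by auto
  obtain y where "p = q * y" using assms(3) idem by (metis rangeE rangeI)
  then have "q * p = p" using idem by (metis mult.assoc)
  obtain z where "q = p * z" using assms(3) idem by (metis rangeE rangeI)
  then have "p * q = q" using idem by (metis mult.assoc)
  then show ?thesis using \<open>q * p = p\<close> sa by (metis star_mult)
qed

lemma rp_ex1:
  fixes a :: "'a::baer_star_ring"
  shows "\<exists>!p. p \<in> projections \<and> {x. a * x = 0} = range (\<lambda>y. (ring_unit - p) * y)"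
proof (rule ex_ex1I)
  obtain q :: 'a where q: "q \<in> projections" "{x. a * x = 0} = range (\<lambda>x. q * x)"
    using baer[of "{a}"] unfolding projections_def by auto
  show "\<exists>p. p \<in> projections \<and> {x. a * x = 0} = range (\<lambda>y. (ring_unit - p) * y)"
    using q compl_projections[OF q(1)] by (intro exI[of _ "ring_unit - q"]) simp
next
  fix p q :: 'a
  assume "p \<in> projections \<and> {x. a * x = 0} = range (\<lambda>y. (ring_unit - p) * y)"
    and "q \<in> projections \<and> {x. a * x = 0} = range (\<lambda>y. (ring_unit - q) * y)"
  then have "ring_unit - p = ring_unit - q"
    by (intro projections_eqI compl_projections) auto
  then show "p = q" by simp
qed

lemma annihilator_star_iff:
  fixes a p :: "'a::baer_star_ring"
  assumes "p \<in> projections"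
  shows "{x. x * a = 0} = range (\<lambda>y. y * (ring_unit - p)) \<longleftrightarrow>
    {x. star a * x = 0} = range (\<lambda>y. (ring_unit - p) * y)"
proof -
  have s: "star (ring_unit - p) = ring_unit - p"
    using compl_projections[OF assms] unfolding projections_def by simp
  have z: "star x = 0 \<longleftrightarrow> x = 0" for x :: 'a by (metis star_star star_zero)
  have inj: "inj (star :: 'a \<Rightarrow> 'a)" by (metis injI star_star)
  have 1: "star ` {x. x * a = 0} = {x. star a * x = 0}"
    by (auto simp: image_iff star_mult[symmetric]) (metis star_mult star_star z)
  have "star ` range (\<lambda>y. y * (ring_unit - p)) = range (\<lambda>y. (ring_unit - p) * star y)"
    by (simp add: image_image star_mult s)
  also have "\<dots> = range (\<lambda>y. (ring_unit - p) * y)"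
    by (auto simp: image_iff) (metis star_star)
  finally show ?thesis using 1 inj by (metis inj_image_eq_iff)
qed

lemma lp_ex1:
  fixes a :: "'a::baer_star_ring"
  shows "\<exists>!p. p \<in> projections \<and> {x. x * a = 0} = range (\<lambda>y. y * (ring_unit - p))"
  using rp_ex1[of "star a"] by (simp add: annihilator_star_iff cong: conj_cong)

definition proj_lattice :: "'a::baer_star_ring gorder" where
  "proj_lattice = \<lparr>carrier = projections, eq = (=), le = (\<lambda>p q. p = p * q)\<rparr>"

lemma complete_lattice_proj_lattice:
  "complete_lattice (proj_lattice :: 'a::baer_star_ring gorder)"
proof -
  interpret partial_order "proj_lattice :: 'a gorder"
  proof unfold_locales
    fix p q r :: 'a
    show "p \<sqsubseteq>\<^bsub>proj_lattice\<^esub> p" if "p \<in> carrier proj_lattice"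
      using that by (simp add: proj_lattice_def projections_def)
    show "p .=\<^bsub>proj_lattice\<^esub> q" if "p \<sqsubseteq>\<^bsub>proj_lattice\<^esub> q" "q \<sqsubseteq>\<^bsub>proj_lattice\<^esub> p"
      "p \<in> carrier proj_lattice" "q \<in> carrier proj_lattice"
      using that by (simp add: proj_lattice_def projections_def) (metis star_mult)
    show "p \<sqsubseteq>\<^bsub>proj_lattice\<^esub> r" if "p \<sqsubseteq>\<^bsub>proj_lattice\<^esub> q" "q \<sqsubseteq>\<^bsub>proj_lattice\<^esub> r"
      using that by (simp add: proj_lattice_def) (metis mult.assoc)
  qed (auto simp: proj_lattice_def)
  show ?thesis
  proof (rule complete_lattice_criterion1)
    show "\<exists>g. greatest proj_lattice g (carrier (proj_lattice :: 'a gorder))"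
      by (rule exI[of _ ring_unit])
        (simp add: greatest_def proj_lattice_def projections_def)
  next
    fix A :: "'a set"
    assume A: "A \<subseteq> carrier proj_lattice" "A \<noteq> {}"
    obtain p where p: "p = star p" "p = p * p"
      "{x. \<forall>s\<in>(\<lambda>s. ring_unit - s) ` A. s * x = 0} = range (\<lambda>x. p * x)"
      using baer[of "(\<lambda>s. ring_unit - s) ` A"] by blast
    have "p = p * s" if "s \<in> A" for s
    proof -
      have "p \<in> range (\<lambda>x. p * x)" using p(2) by blast
      then have "(ring_unit - s) * p = 0" using p(3) that by blast
      then have "s * p = p" by (simp add: left_diff_distrib)
      moreover have "star s = s" using that A(1) by (auto simp: proj_lattice_def projections_def)
      ultimately show ?thesis using p(1) by (metis star_mult)
    qed
    moreover have "q = q * p" if "q \<in> projections" "\<forall>s\<in>A. q = q * s" for q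
    proof -
      have "(ring_unit - s) * q = 0" if "s \<in> A" for s
      proof -
        have "star s = s" using that A(1) by (auto simp: proj_lattice_def projections_def)
        then have "s * q = q"
          using \<open>q \<in> projections\<close> \<open>\<forall>s\<in>A. q = q * s\<close> that
          by (metis (mono_tags, lifting) mem_Collect_eq projections_def star_mult)
        then show ?thesis by (simp add: left_diff_distrib)
      qed
      then have "q \<in> range (\<lambda>x. p * x)" using p(3) by auto
      then obtain y where "q = p * y" by blast
      then have "p * q = q" using p(2) by (metis mult.assoc)
      then show ?thesis
        using p(1) that(1) by (metis (mono_tags, lifting) mem_Collect_eq projections_def star_mult)
    qed
    ultimately have "greatest proj_lattice p (Lower proj_lattice A)"
      using p(1,2) A(1) by (auto simp: greatest_def Lower_def proj_lattice_def projections_def)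
    then show "\<exists>i. greatest proj_lattice i (Lower proj_lattice A)" by blast
  qed
qed

definition le_rstar :: "'a::baer_star_ring \<Rightarrow> 'a \<Rightarrow> bool" where
  "le_rstar a b \<longleftrightarrow> a * rp b = a \<and> a = b * rp a"

definition le_lstar :: "'a::baer_star_ring \<Rightarrow> 'a \<Rightarrow> bool" where
  "le_lstar a b \<longleftrightarrow> lp a * b = a \<and> a = lp b * a"

definition le_star :: "'a::baer_star_ring \<Rightarrow> 'a \<Rightarrow> bool" where
  "le_star a b \<longleftrightarrow> lp a * b = a \<and> a = b * rp a"

definition with_lsq :: "('a::ring \<Rightarrow> 'a \<Rightarrow> bool) \<Rightarrow> 'a \<Rightarrow> 'a \<Rightarrow> bool" where
  "with_lsq R a b \<longleftrightarrow> R a b \<and> a * a = a * b"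

definition with_rsq :: "('a::ring \<Rightarrow> 'a \<Rightarrow> bool) \<Rightarrow> 'a \<Rightarrow> 'a \<Rightarrow> bool" where
  "with_rsq R a b \<longleftrightarrow> R a b \<and> a * a = b * a"

definition with_sq :: "('a::ring \<Rightarrow> 'a \<Rightarrow> bool) \<Rightarrow> 'a \<Rightarrow> 'a \<Rightarrow> bool" where
  "with_sq R a b \<longleftrightarrow> R a b \<and> a * a = a * b \<and> a * b = b * a"

definition rp_orders :: "('a::baer_star_ring \<Rightarrow> 'a \<Rightarrow> bool) set" where
  "rp_orders =
    {with_lsq le_rstar, with_rsq le_rstar, with_sq le_rstar,
     with_lsq le_star, with_rsq le_star, with_sq le_star}"

definition lp_orders :: "('a::baer_star_ring \<Rightarrow> 'a \<Rightarrow> bool) set" where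
  "lp_orders = {le_lstar, with_lsq le_lstar, with_rsq le_lstar, with_sq le_lstar}"

definition ring_order :: "('a \<Rightarrow> 'a \<Rightarrow> bool) \<Rightarrow> 'a gorder" where
  "ring_order R = \<lparr>carrier = UNIV, eq = (=), le = R\<rparr>"

end

theory Submission
  imports Defs
begin

text \<open>
  Below a fixed \<open>b\<close>, every \<open>a\<close> is \<open>b * p\<close> with \<open>p = rp a \<le> rp b\<close>, and each of the extra conditions
  (either square condition, or the left half of the star order) says that \<open>p\<close> is invariant under an
  element \<open>t b\<close>, that is, \<open>p * t b * p = t b * p\<close>, where \<open>t b\<close> is \<open>star b\<close>, \<open>rp b * b\<close>
  or \<open>star b * b\<close>. Projections invariant under a given element are closed under arbitrary suprema
  and infima, so both bounds are computed among projections. If \<open>u\<close> is another upper bound, then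
  \<open>u - b\<close> annihilates every \<open>rp c\<close>, hence also their supremum, so \<open>u\<close> and \<open>b\<close> give
  the same supremum. The orders based on \<open>lp\<close> are carried to those based on \<open>rp\<close> by the involution.
\<close>

section \<open>Projections, right and left supports, cancellation\<close>

lemma projectionsD:
  assumes "p \<in> projections"
  shows "star p = p" "p * p = p"
  using assms unfolding projections_def by auto

lemma proj_le_commute:
  fixes p q :: "'a::star_ring"
  assumes "p \<in> projections" "q \<in> projections"
  shows "p = p * q \<longleftrightarrow> q * p = p"
  using assms by (metis projectionsD(1) star_mult)

lemma compl_mult_eq_0_iff:
  fixes p x :: "'a::baer_star_ring"
  assumes "p \<in> projections"
  shows "x \<in> range (\<lambda>y. (ring_unit - p) * y) \<longleftrightarrow> p * x = 0"
proof
  assume "x \<in> range (\<lambda>y. (ring_unit - p) * y)"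
  then obtain y where "x = (ring_unit - p) * y" by blast
  then show "p * x = 0"
    using projectionsD[OF assms] by (simp add: left_diff_distrib right_diff_distrib flip: mult.assoc)
next
  assume "p * x = 0"
  then have "x = (ring_unit - p) * x" by (simp add: left_diff_distrib)
  then show "x \<in> range (\<lambda>y. (ring_unit - p) * y)" by blast
qed

text \<open>The cancellation rule of the whole development: in an equation with right-hand side
  zero, a leftmost factor \<open>a\<close> may be exchanged for the projection
  \<open>rp a\<close>.\<close>

lemma
  fixes a :: "'a::baer_star_ring"
  shows rp_in_projections [simp]: "rp a \<in> projections"
    and mult_eq_0_iff_rp: "a * x = 0 \<longleftrightarrow> rp a * x = 0"
proof -
  have *: "rp a \<in> projections \<and> {x. a * x = 0} = range (\<lambda>y. (ring_unit - rp a) * y)"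
    unfolding rp_def by (rule theI'[OF rp_ex1])
  then show "rp a \<in> projections" by blast
  from * have "a * x = 0 \<longleftrightarrow> x \<in> range (\<lambda>y. (ring_unit - rp a) * y)" by blast
  with * show "a * x = 0 \<longleftrightarrow> rp a * x = 0"
    using compl_mult_eq_0_iff[of "rp a" x] by blast
qed

lemma rp_eqI:
  fixes a p :: "'a::baer_star_ring"
  assumes "p \<in> projections" "\<And>x. a * x = 0 \<longleftrightarrow> p * x = 0"
  shows "rp a = p"
proof -
  have "{x. a * x = 0} = range (\<lambda>y. (ring_unit - p) * y)"
    using assms compl_mult_eq_0_iff by blast
  then show ?thesis
    unfolding rp_def using assms(1) by (intro the1_equality[OF rp_ex1]) blast
qed

lemma mult_rp [simp]: "a * rp a = (a::'a::baer_star_ring)"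
proof -
  have "rp a * (ring_unit - rp a) = 0"
    using projectionsD(2)[OF rp_in_projections[of a]] by (simp add: right_diff_distrib)
  then have "a * (ring_unit - rp a) = 0" using mult_eq_0_iff_rp by blast
  then show ?thesis by (simp add: right_diff_distrib)
qed

lemma lp_eq_rp_star: "lp a = rp (star a :: 'a::baer_star_ring)"
  unfolding lp_def rp_def by (simp add: annihilator_star_iff cong: conj_cong)

lemma lp_in_projections [simp]: "lp (a::'a::baer_star_ring) \<in> projections"
  by (simp add: lp_eq_rp_star)

lemma lp_mult [simp]: "lp a * a = (a::'a::baer_star_ring)"
  by (metis lp_eq_rp_star lp_in_projections mult_rp projectionsD(1) star_mult star_star)

text \<open>For \<open>p\<close> below \<open>rp b\<close>, left multiplication by \<open>b\<close>
  loses nothing on multiples of \<open>p\<close>: cancelling \<open>b\<close> to \<open>rp b\<close>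
  leaves \<open>p * x\<close> unchanged.\<close>

lemma rp_mult_projection:
  fixes b p :: "'a::baer_star_ring"
  assumes "p \<in> projections" "rp b * p = p"
  shows "rp (b * p) = p"
proof (rule rp_eqI[OF assms(1)])
  show "b * p * x = 0 \<longleftrightarrow> p * x = 0" for x
  proof -
    have "b * p * x = 0 \<longleftrightarrow> rp b * (p * x) = 0"
      unfolding mult.assoc by (rule mult_eq_0_iff_rp)
    also have "rp b * (p * x) = p * x" unfolding mult.assoc[symmetric] assms(2) ..
    finally show ?thesis .
  qed
qed

section \<open>Suprema, infima and invariance in the projection lattice\<close>

abbreviation proj_Sup :: "'a::baer_star_ring set \<Rightarrow> 'a" where
  "proj_Sup S \<equiv> \<Squnion>\<^bsub>proj_lattice\<^esub> S"

abbreviation proj_Inf :: "'a::baer_star_ring set \<Rightarrow> 'a" where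
  "proj_Inf S \<equiv> \<Sqinter>\<^bsub>proj_lattice\<^esub> S"

lemma
  fixes S :: "'a::baer_star_ring set"
  assumes "S \<subseteq> projections"
  shows proj_Sup_in_projections: "proj_Sup S \<in> projections"
    and proj_Sup_upper: "p \<in> S \<Longrightarrow> proj_Sup S * p = p"
    and proj_Sup_least: "q \<in> projections \<Longrightarrow> (\<And>p. p \<in> S \<Longrightarrow> q * p = p) \<Longrightarrow> q * proj_Sup S = proj_Sup S"
    and proj_Inf_in_projections: "proj_Inf S \<in> projections"
    and proj_Inf_lower: "p \<in> S \<Longrightarrow> p * proj_Inf S = proj_Inf S"
    and proj_Inf_greatest: "q \<in> projections \<Longrightarrow> (\<And>p. p \<in> S \<Longrightarrow> p * q = q) \<Longrightarrow> proj_Inf S * q = q"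
proof -
  interpret L: complete_lattice "proj_lattice :: 'a gorder"
    by (rule complete_lattice_proj_lattice)
  have le: "p \<sqsubseteq>\<^bsub>proj_lattice\<^esub> q \<longleftrightarrow> q * p = p"
    if "p \<in> projections" "q \<in> projections" for p q :: 'a
    using proj_le_commute[OF that] by (auto simp: proj_lattice_def)
  have c: "carrier (proj_lattice :: 'a gorder) = projections"
    by (simp add: proj_lattice_def)
  note S = assms[folded c]
  show sup: "proj_Sup S \<in> projections" and inf: "proj_Inf S \<in> projections"
    using L.sup_closed[OF S] L.inf_closed[OF S] c by auto
  show "proj_Sup S * p = p" if "p \<in> S"
    using L.sup_upper[OF S that] le sup assms that by blast
  show "p * proj_Inf S = proj_Inf S" if "p \<in> S"
    using L.inf_lower[OF S that] le inf assms that by blast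
  show "q * proj_Sup S = proj_Sup S" if "q \<in> projections" "\<And>p. p \<in> S \<Longrightarrow> q * p = p"
  proof -
    have "q \<in> Upper proj_lattice S"
      using that le assms c unfolding Upper_def by blast
    then have "proj_Sup S \<sqsubseteq>\<^bsub>proj_lattice\<^esub> q"
      using L.sup_lub[OF S] unfolding least_def by blast
    then show ?thesis using le[OF sup that(1)] by simp
  qed
  show "proj_Inf S * q = q" if "q \<in> projections" "\<And>p. p \<in> S \<Longrightarrow> p * q = q"
  proof -
    have "q \<in> Lower proj_lattice S"
      using that le assms c unfolding Lower_def by blast
    then have "q \<sqsubseteq>\<^bsub>proj_lattice\<^esub> proj_Inf S"
      using L.inf_glb[OF S] unfolding greatest_def by blast
    then show ?thesis using le[OF that(1) inf] by simp
  qed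
qed

text \<open>Agreement of \<open>x\<close> and \<open>y\<close> on \<open>p\<close> means that
  \<open>p\<close> lies below the complement of \<open>rp (x - y)\<close>. This complement is itself
  a projection, so it also bounds the supremum.\<close>

lemma mult_proj_Sup_eqI:
  fixes x y :: "'a::baer_star_ring"
  assumes S: "S \<subseteq> projections" and eq: "\<And>p. p \<in> S \<Longrightarrow> x * p = y * p"
  shows "x * proj_Sup S = y * proj_Sup S"
proof -
  let ?r = "rp (x - y)"
  have "(ring_unit - ?r) * p = p" if "p \<in> S" for p
  proof -
    have "(x - y) * p = 0" using eq[OF that] by (simp add: left_diff_distrib)
    then have "?r * p = 0" using mult_eq_0_iff_rp by blast
    then show ?thesis by (simp add: left_diff_distrib)
  qed
  then have "(ring_unit - ?r) * proj_Sup S = proj_Sup S"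
    by (intro proj_Sup_least[OF S] compl_projections) simp_all
  then have "?r * proj_Sup S = 0" by (simp add: left_diff_distrib)
  then have "(x - y) * proj_Sup S = 0" using mult_eq_0_iff_rp by blast
  then show ?thesis by (simp add: left_diff_distrib)
qed

text \<open>An equation \<open>p * y = y\<close> says that \<open>lp y\<close> is below
  \<open>p\<close>. Thus \<open>lp y\<close> is a lower bound of \<open>S\<close> in the lattice,
  hence below the infimum.\<close>

lemma proj_Inf_mult_fixed:
  fixes y :: "'a::baer_star_ring"
  assumes S: "S \<subseteq> projections" and eq: "\<And>p. p \<in> S \<Longrightarrow> p * y = y"
  shows "proj_Inf S * y = y"
proof -
  have "p * lp y = lp y" if "p \<in> S" for p
  proof -
    have "star y * (ring_unit - p) = 0"
      using eq[OF that] S that projectionsD(1)[of p]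
      by (simp add: right_diff_distrib) (metis star_mult subsetD)
    then have "lp y * (ring_unit - p) = 0" by (metis lp_eq_rp_star mult_eq_0_iff_rp)
    then have "lp y = lp y * p" by (simp add: right_diff_distrib)
    then show ?thesis using proj_le_commute[of "lp y" p] S that by auto
  qed
  then have "proj_Inf S * lp y = lp y" by (intro proj_Inf_greatest[OF S]) simp_all
  then show ?thesis by (metis lp_mult mult.assoc)
qed

text \<open>It suffices to compare both sides on each \<open>p\<close> in \<open>S\<close>, where
  invariance writes \<open>t * p\<close> as \<open>p * t * p\<close> and the supremum absorbs the
  leading \<open>p\<close>.\<close>

lemma proj_Sup_invariant:
  fixes t :: "'a::baer_star_ring"
  assumes S: "S \<subseteq> projections" and inv: "\<And>p. p \<in> S \<Longrightarrow> p * t * p = t * p"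
  shows "proj_Sup S * t * proj_Sup S = t * proj_Sup S"
proof (rule mult_proj_Sup_eqI[OF S])
  fix p assume "p \<in> S"
  then show "proj_Sup S * t * p = t * p"
    using inv proj_Sup_upper[OF S] by (metis mult.assoc)
qed

text \<open>Inserting \<open>p\<close> between \<open>t\<close> and the infimum and using invariance
  shows that each \<open>p\<close> in \<open>S\<close> fixes \<open>t * proj_Inf S\<close>; then so
  does the infimum.\<close>

lemma proj_Inf_invariant:
  fixes t :: "'a::baer_star_ring"
  assumes S: "S \<subseteq> projections" and inv: "\<And>p. p \<in> S \<Longrightarrow> p * t * p = t * p"
  shows "proj_Inf S * t * proj_Inf S = t * proj_Inf S"
proof -
  have "p * (t * proj_Inf S) = t * proj_Inf S" if "p \<in> S" for p
    using inv[OF that] proj_Inf_lower[OF S that] by (metis mult.assoc)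
  from proj_Inf_mult_fixed[OF S this] show ?thesis by (simp add: mult.assoc)
qed

section \<open>The order conditions as invariance of \<open>rp a\<close>\<close>

lemma le_rstar_alt: "le_rstar a b \<longleftrightarrow> rp b * rp a = rp a \<and> a = b * rp (a::'a::baer_star_ring)"
proof -
  have "a * rp b = a \<longleftrightarrow> rp a = rp a * rp b"
  proof -
    have "a * rp b = a \<longleftrightarrow> a * (ring_unit - rp b) = 0" by (auto simp: right_diff_distrib)
    also have "\<dots> \<longleftrightarrow> rp a = rp a * rp b"
      using mult_eq_0_iff_rp[of a "ring_unit - rp b"] by (simp add: right_diff_distrib)
    finally show ?thesis .
  qed
  then show ?thesis by (simp add: le_rstar_def proj_le_commute)
qed

lemma le_rstar_antisym: "le_rstar a b \<Longrightarrow> le_rstar b a \<Longrightarrow> a = (b::'a::baer_star_ring)"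
  by (metis le_rstar_def mult_rp)

lemma star_eq_iff: "star x = star y \<longleftrightarrow> x = (y::'a::star_ring)"
  by (metis star_star)

lemma invariant_star_iff:
  fixes p t :: "'a::star_ring"
  assumes "p \<in> projections"
  shows "p * star t * p = star t * p \<longleftrightarrow> p * t * p = p * t"
  using star_eq_iff[of "p * t * p" "p * t"] projectionsD(1)[OF assms]
  by (simp add: star_mult mult.assoc)

text \<open>Cancelling the left factor of \<open>a * (a - b) = 0\<close> to \<open>rp a\<close>
  gives invariance on the other side, \<open>rp a * b * rp a = rp a * b\<close>. Taking adjoints
  moves it to the right and turns \<open>b\<close> into \<open>star b\<close>.\<close>

lemma le_rstar_lsq_iff:
  fixes a b :: "'a::baer_star_ring"
  assumes "le_rstar a b"
  shows "a * a = a * b \<longleftrightarrow> rp a * star b * rp a = star b * rp a"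
proof -
  have a: "a = b * rp a" using assms le_rstar_alt by blast
  have "a * a = a * b \<longleftrightarrow> a * (a - b) = 0" by (simp add: right_diff_distrib)
  also have "\<dots> \<longleftrightarrow> rp a * (a - b) = 0" by (rule mult_eq_0_iff_rp)
  also have "\<dots> \<longleftrightarrow> rp a * b * rp a = rp a * b"
    using a by (simp add: right_diff_distrib mult.assoc)
  also have "\<dots> \<longleftrightarrow> rp a * star b * rp a = star b * rp a"
    by (simp add: invariant_star_iff)
  finally show ?thesis .
qed

text \<open>Here the factor to cancel is \<open>b\<close>, because
  \<open>a * a - b * a = b * (rp a * a - a)\<close>. Cancellation leaves \<open>rp b\<close> in
  front of the bracket, hence the operator \<open>rp b * b\<close> instead of
  \<open>b\<close>.\<close>

lemma le_rstar_rsq_iff: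
  fixes a b :: "'a::baer_star_ring"
  assumes "le_rstar a b"
  shows "a * a = b * a \<longleftrightarrow> rp a * (rp b * b) * rp a = rp b * b * rp a"
proof -
  have a: "a = b * rp a" and le: "rp b * rp a = rp a" using assms le_rstar_alt by blast+
  have le': "rp a * rp b = rp a" using le by (simp add: flip: proj_le_commute)
  have "a * a = b * a \<longleftrightarrow> b * (rp a * a - a) = 0"
    using a by (simp add: right_diff_distrib flip: mult.assoc)
  also have "\<dots> \<longleftrightarrow> rp b * (rp a * a - a) = 0" by (rule mult_eq_0_iff_rp)
  also have "\<dots> \<longleftrightarrow> rp a * a = rp b * a"
    using le by (simp add: right_diff_distrib flip: mult.assoc)
  also have "\<dots> \<longleftrightarrow> rp a * (rp b * b) * rp a = rp b * b * rp a"
    using a le' by (metis mult.assoc)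
  finally show ?thesis .
qed

text \<open>Since \<open>lp a\<close> is \<open>rp (star a)\<close>, the equation
  \<open>lp a * (b - a) = 0\<close> may be read with \<open>star a = rp a * star b\<close> in place
  of \<open>lp a\<close>. The operator \<open>star b * b\<close> is self-adjoint, so left and right
  invariance coincide.\<close>

lemma le_star_iff:
  fixes a b :: "'a::baer_star_ring"
  shows "le_star a b \<longleftrightarrow> le_rstar a b \<and> rp a * (star b * b) * rp a = star b * b * rp a"
proof -
  have "lp a * b = a \<longleftrightarrow> rp a * (star b * b) * rp a = star b * b * rp a" if a: "a = b * rp a"
  proof -
    have sa: "star a = rp a * star b"
      using a by (metis projectionsD(1) rp_in_projections star_mult)
    have "lp a * b = a \<longleftrightarrow> lp a * (b - a) = 0" by (simp add: right_diff_distrib)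
    also have "\<dots> \<longleftrightarrow> star a * (b - a) = 0" by (metis lp_eq_rp_star mult_eq_0_iff_rp)
    also have "\<dots> \<longleftrightarrow> rp a * (star b * b) * rp a = rp a * (star b * b)"
      using a sa by (simp add: right_diff_distrib) (metis mult.assoc)
    also have "\<dots> \<longleftrightarrow> rp a * (star b * b) * rp a = star b * b * rp a"
      using invariant_star_iff[of "rp a" "star b * b"] by (simp add: star_mult)
    finally show ?thesis .
  qed
  moreover have "a * rp b = a" if "lp a * b = a"
    using that by (metis mult.assoc mult_rp)
  ultimately show ?thesis unfolding le_star_def le_rstar_def by auto
qed

section \<open>A common form for the \<open>rp\<close> orders\<close>

text \<open>\<open>T\<close> consists of functions because the operators depend on the larger
  element. A set allows several conditions at once, and the empty one gives plain
  \<open>le_rstar\<close>.\<close>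

definition invariant_order :: "('a \<Rightarrow> 'a) set \<Rightarrow> 'a::baer_star_ring \<Rightarrow> 'a \<Rightarrow> bool" where
  "invariant_order T a b \<longleftrightarrow> le_rstar a b \<and> (\<forall>t\<in>T. rp a * t b * rp a = t b * rp a)"

text \<open>
  Coherence makes invariance relative to \<open>b\<close> and relative to \<open>a\<close> the same condition on
  projections below \<open>rp a\<close>; it yields transitivity.
\<close>

definition coherent :: "('a::baer_star_ring \<Rightarrow> 'a) \<Rightarrow> bool" where
  "coherent t \<longleftrightarrow>
    (\<forall>a b. le_rstar a b \<longrightarrow> rp a * t b * rp a = t b * rp a \<longrightarrow> t a * rp a = t b * rp a)"

text \<open>For all three operators, substituting \<open>a = b * rp a\<close> turns
  \<open>t a * rp a\<close> into the compression \<open>rp a * t b * rp a\<close>, which invariance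
  identifies with \<open>t b * rp a\<close>.\<close>

lemma coherent_star: "coherent star"
  unfolding coherent_def le_rstar_alt
  by (metis projectionsD(1) rp_in_projections star_mult)

lemma coherent_rp_mult: "coherent (\<lambda>b. rp b * b)"
  unfolding coherent_def
proof (intro allI impI)
  fix a b :: 'a
  assume "le_rstar a b" and inv: "rp a * (rp b * b) * rp a = rp b * b * rp a"
  then have a: "a = b * rp a" and "rp b * rp a = rp a" using le_rstar_alt by blast+
  then have "rp a * rp b = rp a" by (simp add: flip: proj_le_commute)
  then show "rp a * a * rp a = rp b * b * rp a" using a inv by (metis mult.assoc mult_rp)
qed

lemma coherent_star_mult: "coherent (\<lambda>b. star b * b)"
  unfolding coherent_def le_rstar_alt
  by (metis mult.assoc mult_rp projectionsD(1) rp_in_projections star_mult)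

lemma rp_orders_invariant:
  fixes R :: "'a::baer_star_ring \<Rightarrow> 'a \<Rightarrow> bool"
  assumes "R \<in> rp_orders"
  obtains T where "\<And>t. t \<in> T \<Longrightarrow> coherent t" "R = invariant_order T"
proof -
  let ?r = "\<lambda>b::'a. rp b * b" and ?s = "\<lambda>b::'a. star b * b"
  \<comment> \<open>Each square condition and the star order contribute one operator. In
    \<open>with_sq\<close>, once \<open>a * a = a * b\<close> holds, the other equation amounts to
    \<open>a * a = b * a\<close>, so both square operators occur.\<close>
  have eqs: "with_lsq le_rstar = invariant_order {star :: 'a \<Rightarrow> 'a}"
    "with_rsq le_rstar = invariant_order {?r}"
    "with_sq le_rstar = invariant_order {star, ?r}"
    "with_lsq le_star = invariant_order {star, ?s}"
    "with_rsq le_star = invariant_order {?r, ?s}"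
    "with_sq le_star = invariant_order {star, ?r, ?s}"
    by (intro ext; simp add: with_lsq_def with_rsq_def with_sq_def invariant_order_def le_star_iff
        flip: le_rstar_lsq_iff le_rstar_rsq_iff cong: conj_cong; metis)+
  have "rp_orders = invariant_order ` {{star}, {?r}, {star, ?r}, {star, ?s}, {?r, ?s}, {star, ?r, ?s}}"
    unfolding rp_orders_def eqs by (simp only: image_insert image_empty)
  then obtain T where T: "T \<in> {{star}, {?r}, {star, ?r}, {star, ?s}, {?r, ?s}, {star, ?r, ?s}}"
    and R: "R = invariant_order T"
    using assms by blast
  have "T \<subseteq> {star, ?r, ?s}" using T by (elim insertE emptyE) simp_all
  then have "coherent t" if "t \<in> T" for t
    using that coherent_star coherent_rp_mult coherent_star_mult by blast
  then show thesis using R that by blast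
qed

text \<open>By \<open>c = b * rp c\<close> and coherence, passing from \<open>b\<close> to
  \<open>c\<close> or from \<open>t b\<close> to \<open>t c\<close> changes no product with a
  projection below \<open>rp c\<close>, and the conditions on \<open>a\<close> involve only such
  products.\<close>

lemma invariant_order_cong:
  fixes a b c :: "'a::baer_star_ring"
  assumes T: "\<And>t. t \<in> T \<Longrightarrow> coherent t" and cb: "invariant_order T c b"
    and le: "rp c * rp a = rp a"
  shows "invariant_order T a c \<longleftrightarrow> invariant_order T a b"
proof -
  have c: "c = b * rp c" "rp b * rp c = rp c"
    using cb unfolding invariant_order_def le_rstar_alt by blast+
  have "c * rp a = b * rp a" "rp b * rp a = rp a" using c le by (metis mult.assoc)+
  moreover have "t c * rp a = t b * rp a" if "t \<in> T" for t
  proof -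
    have "t c * rp c = t b * rp c"
      using T[OF that] cb that unfolding invariant_order_def coherent_def by blast
    then show ?thesis using le by (metis mult.assoc)
  qed
  ultimately show ?thesis
    using le unfolding invariant_order_def le_rstar_alt by (simp add: mult.assoc)
qed

lemma invariant_order_trans:
  fixes a b c :: "'a::baer_star_ring"
  assumes "\<And>t. t \<in> T \<Longrightarrow> coherent t" "invariant_order T a c" "invariant_order T c b"
  shows "invariant_order T a b"
  using assms invariant_order_cong[of T c b a] unfolding invariant_order_def le_rstar_alt by blast

lemma invariant_order_mult:
  fixes b p :: "'a::baer_star_ring"
  assumes "p \<in> projections" "rp b * p = p" "\<And>t. t \<in> T \<Longrightarrow> p * t b * p = t b * p"
  shows "invariant_order T (b * p) b"
  using assms unfolding invariant_order_def le_rstar_alt by (simp add: rp_mult_projection)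

lemma invariant_order_Sup:
  fixes b :: "'a::baer_star_ring"
  assumes "\<And>c. c \<in> B \<Longrightarrow> invariant_order T c b"
  shows "invariant_order T (b * proj_Sup (rp ` B)) b" "rp (b * proj_Sup (rp ` B)) = proj_Sup (rp ` B)"
proof -
  have S: "rp ` B \<subseteq> projections" by auto
  have "rp b * proj_Sup (rp ` B) = proj_Sup (rp ` B)"
    using assms by (intro proj_Sup_least[OF S]) (auto simp: invariant_order_def le_rstar_alt)
  note le = proj_Sup_in_projections[OF S] this
  show "rp (b * proj_Sup (rp ` B)) = proj_Sup (rp ` B)"
    by (rule rp_mult_projection[OF le])
  show "invariant_order T (b * proj_Sup (rp ` B)) b"
    using assms by (intro invariant_order_mult[OF le] proj_Sup_invariant[OF S])
      (auto simp: invariant_order_def)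
qed

lemma invariant_order_Inf:
  fixes b :: "'a::baer_star_ring"
  assumes "\<And>c. c \<in> B \<Longrightarrow> invariant_order T c b" "B \<noteq> {}"
  shows "invariant_order T (b * proj_Inf (rp ` B)) b" "rp (b * proj_Inf (rp ` B)) = proj_Inf (rp ` B)"
proof -
  have S: "rp ` B \<subseteq> projections" by auto
  \<comment> \<open>A member is needed to push the infimum below \<open>rp b\<close>; the infimum of
    the empty set would be the identity.\<close>
  obtain c where c: "c \<in> B" using assms(2) by blast
  then have "rp b * rp c = rp c" "rp c * proj_Inf (rp ` B) = proj_Inf (rp ` B)"
    using assms(1) proj_Inf_lower[OF S] by (auto simp: invariant_order_def le_rstar_alt)
  then have "rp b * proj_Inf (rp ` B) = proj_Inf (rp ` B)" by (metis mult.assoc)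
  note le = proj_Inf_in_projections[OF S] this
  show "rp (b * proj_Inf (rp ` B)) = proj_Inf (rp ` B)"
    by (rule rp_mult_projection[OF le])
  show "invariant_order T (b * proj_Inf (rp ` B)) b"
    using assms by (intro invariant_order_mult[OF le] proj_Inf_invariant[OF S])
      (auto simp: invariant_order_def)
qed

section \<open>Bounds in the ordered ring\<close>

lemma least_ring_order_iff:
  "least (ring_order R) s (Upper (ring_order R) B) \<longleftrightarrow>
    (\<forall>c\<in>B. R c s) \<and> (\<forall>u. (\<forall>c\<in>B. R c u) \<longrightarrow> R s u)"
  by (auto simp: least_def Upper_def ring_order_def)

lemma greatest_ring_order_iff:
  "greatest (ring_order R) i (Lower (ring_order R) B) \<longleftrightarrow>
    (\<forall>c\<in>B. R i c) \<and> (\<forall>d. (\<forall>c\<in>B. R d c) \<longrightarrow> R d i)"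
  by (auto simp: greatest_def Lower_def ring_order_def)

text \<open>The lattice operation is defined by a choice operator; antisymmetry determines which
  element is chosen.\<close>

lemma sup_ring_order_eqI:
  assumes "least (ring_order R) s (Upper (ring_order R) B)" "\<And>a b. R a b \<Longrightarrow> R b a \<Longrightarrow> a = b"
  shows "\<Squnion>\<^bsub>ring_order R\<^esub> B = s"
  unfolding sup_def using assms by (intro some_equality) (auto simp: least_ring_order_iff)

lemma inf_ring_order_eqI:
  assumes "greatest (ring_order R) i (Lower (ring_order R) B)" "\<And>a b. R a b \<Longrightarrow> R b a \<Longrightarrow> a = b"
  shows "\<Sqinter>\<^bsub>ring_order R\<^esub> B = i"
  unfolding inf_def using assms by (intro some_equality) (auto simp: greatest_ring_order_iff)

lemma invariant_order_least:
  fixes b :: "'a::baer_star_ring"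
  assumes T: "\<And>t. t \<in> T \<Longrightarrow> coherent t" and B: "\<And>c. c \<in> B \<Longrightarrow> invariant_order T c b"
  shows "least (ring_order (invariant_order T)) (b * proj_Sup (rp ` B))
    (Upper (ring_order (invariant_order T)) B)"
  unfolding least_ring_order_iff
proof (intro conjI ballI allI impI)
  have S: "rp ` B \<subseteq> projections" by auto
  \<comment> \<open>Both \<open>c\<close> and the candidate lie below \<open>b\<close>, so comparing
    them reduces to comparing their right projections.\<close>
  fix c assume "c \<in> B"
  then show "invariant_order T c (b * proj_Sup (rp ` B))"
    using invariant_order_cong[OF T invariant_order_Sup(1)[OF B]] B proj_Sup_upper[OF S]
    by (auto simp: invariant_order_Sup(2)[OF B])
next
  have S: "rp ` B \<subseteq> projections" by auto
  fix u assume u: "\<forall>c\<in>B. invariant_order T c u"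
  have "b * proj_Sup (rp ` B) = u * proj_Sup (rp ` B)"
  proof (rule mult_proj_Sup_eqI[OF S])
    fix p assume "p \<in> rp ` B"
    then obtain c where c: "c \<in> B" "p = rp c" by blast
    then show "b * p = u * p"
      using B[OF c(1)] u unfolding invariant_order_def le_rstar_alt by metis
  qed
  \<comment> \<open>Rewritten with \<open>u\<close> in place of \<open>b\<close>, the candidate is
    below \<open>u\<close> for the same reason that it is below \<open>b\<close>.\<close>
  then show "invariant_order T (b * proj_Sup (rp ` B)) u"
    using invariant_order_Sup(1)[of B T u] u by auto
qed

lemma invariant_order_greatest:
  fixes b :: "'a::baer_star_ring"
  assumes T: "\<And>t. t \<in> T \<Longrightarrow> coherent t" and B: "\<And>c. c \<in> B \<Longrightarrow> invariant_order T c b"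
    and ne: "B \<noteq> {}"
  shows "greatest (ring_order (invariant_order T)) (b * proj_Inf (rp ` B))
    (Lower (ring_order (invariant_order T)) B)"
  unfolding greatest_ring_order_iff
proof (intro conjI ballI allI impI)
  have S: "rp ` B \<subseteq> projections" by auto
  note I = invariant_order_Inf[OF B ne]
  fix c assume "c \<in> B"
  then show "invariant_order T (b * proj_Inf (rp ` B)) c"
    using invariant_order_cong[OF T B] I proj_Inf_lower[OF S] by auto
next
  have S: "rp ` B \<subseteq> projections" by auto
  note I = invariant_order_Inf[OF B ne]
  \<comment> \<open>Transitivity through a member of \<open>B\<close> puts \<open>d\<close> below
    \<open>b\<close>, so again only right projections remain to be compared.\<close>
  fix d assume d: "\<forall>c\<in>B. invariant_order T d c"
  then have "invariant_order T d b"
    using invariant_order_trans[OF T] B ne by blast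
  moreover have "proj_Inf (rp ` B) * rp d = rp d"
    using d by (intro proj_Inf_greatest[OF S]) (auto simp: invariant_order_def le_rstar_alt)
  ultimately show "invariant_order T d (b * proj_Inf (rp ` B))"
    using invariant_order_cong[OF T I(1)] I(2) by auto
qed

section \<open>The \<open>lp\<close> orders through the involution\<close>

text \<open>The involution reverses products, so it exchanges the two one-sided square conditions
  and carries \<open>le_lstar\<close> to \<open>le_rstar\<close>, the case of empty
  \<open>T\<close>.\<close>

lemma lp_orders_invariant:
  fixes R :: "'a::baer_star_ring \<Rightarrow> 'a \<Rightarrow> bool"
  assumes "R \<in> lp_orders"
  obtains T where "\<And>t. t \<in> T \<Longrightarrow> coherent t" "R = (\<lambda>a b. invariant_order T (star a) (star b))"
proof -
  have l: "le_lstar a b \<longleftrightarrow> le_rstar (star a) (star b)" for a b :: 'a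
    unfolding le_lstar_def le_rstar_def lp_eq_rp_star
    by (metis projectionsD(1) rp_in_projections star_mult star_star)
  have 0: "le_rstar = invariant_order {}" by (intro ext) (simp add: invariant_order_def)
  have w: "with_lsq le_lstar = (\<lambda>a b. with_rsq le_rstar (star a) (star (b::'a)))"
    "with_rsq le_lstar = (\<lambda>a b. with_lsq le_rstar (star a) (star (b::'a)))"
    "with_sq le_lstar = (\<lambda>a b. with_sq le_rstar (star a) (star (b::'a)))"
    by (auto simp: fun_eq_iff with_lsq_def with_rsq_def with_sq_def l star_eq_iff simp flip: star_mult)
  have "\<exists>Q. R = (\<lambda>a b. Q (star a) (star b)) \<and> (Q = le_rstar \<or> Q \<in> rp_orders)"
    using assms w l unfolding lp_orders_def rp_orders_def by (elim insertE emptyE) blast+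
  then obtain Q where "R = (\<lambda>a b. Q (star a) (star b))" "Q = le_rstar \<or> Q \<in> rp_orders"
    by blast
  then show thesis using that 0 by (metis empty_iff rp_orders_invariant)
qed

lemma bounds_star_transport:
  fixes Q :: "'a::star_ring \<Rightarrow> 'a \<Rightarrow> bool"
  defines "R \<equiv> \<lambda>a b. Q (star a) (star b)"
  shows "least (ring_order Q) s (Upper (ring_order Q) (star ` B)) \<Longrightarrow>
      least (ring_order R) (star s) (Upper (ring_order R) B)"
    and "greatest (ring_order Q) s (Lower (ring_order Q) (star ` B)) \<Longrightarrow>
      greatest (ring_order R) (star s) (Lower (ring_order R) B)"
  by (simp_all add: least_ring_order_iff greatest_ring_order_iff R_def)

theorem theorem45:
  fixes R :: "'a::regular_baer_star_ring \<Rightarrow> 'a \<Rightarrow> bool"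
    and B :: "'a set" and b :: 'a
  assumes "R \<in> rp_orders \<union> lp_orders"
    and "B \<noteq> {}"
    and "b \<in> Upper (ring_order R) B"
  shows "(\<exists>s. least (ring_order R) s (Upper (ring_order R) B)) \<and>
    (\<exists>i. greatest (ring_order R) i (Lower (ring_order R) B)) \<and>
    (R \<in> rp_orders \<longrightarrow>
      \<Squnion>\<^bsub>ring_order R\<^esub> B = b * \<Squnion>\<^bsub>proj_lattice\<^esub> (rp ` B) \<and>
      \<Sqinter>\<^bsub>ring_order R\<^esub> B = b * \<Sqinter>\<^bsub>proj_lattice\<^esub> (rp ` B)) \<and>
    (R \<in> lp_orders \<longrightarrow>
      \<Squnion>\<^bsub>ring_order R\<^esub> B = \<Squnion>\<^bsub>proj_lattice\<^esub> (lp ` B) * b \<and>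
      \<Sqinter>\<^bsub>ring_order R\<^esub> B = \<Sqinter>\<^bsub>proj_lattice\<^esub> (lp ` B) * b)"
proof -
  have B: "R c b" if "c \<in> B" for c
    using assms(3) that by (auto simp: Upper_def ring_order_def)
  \<comment> \<open>Existence and the explicit formulas are proved together, from the same pair of
    witnesses.\<close>
  let ?P = "\<lambda>s i. least (ring_order R) s (Upper (ring_order R) B) \<and>
    greatest (ring_order R) i (Lower (ring_order R) B) \<and>
    \<Squnion>\<^bsub>ring_order R\<^esub> B = s \<and> \<Sqinter>\<^bsub>ring_order R\<^esub> B = i"
  have "?P (b * proj_Sup (rp ` B)) (b * proj_Inf (rp ` B))" if "R \<in> rp_orders"
  proof -
    obtain T where T: "\<And>t. t \<in> T \<Longrightarrow> coherent t" and R: "R = invariant_order T"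
      using rp_orders_invariant[OF \<open>R \<in> rp_orders\<close>] by blast
    have anti: "x = y" if "R x y" "R y x" for x y
      using that le_rstar_antisym unfolding R invariant_order_def by blast
    note l = invariant_order_least[OF T B[unfolded R], folded R]
      and g = invariant_order_greatest[OF T B[unfolded R] assms(2), folded R]
    show ?thesis
      using l g sup_ring_order_eqI[OF l anti] inf_ring_order_eqI[OF g anti] by blast
  qed
  moreover have "?P (proj_Sup (lp ` B) * b) (proj_Inf (lp ` B) * b)" if "R \<in> lp_orders"
  proof -
    obtain T where T: "\<And>t. t \<in> T \<Longrightarrow> coherent t"
      and R: "R = (\<lambda>a b. invariant_order T (star a) (star b))"
      using lp_orders_invariant[OF \<open>R \<in> lp_orders\<close>] by blast
    have anti: "x = y" if "R x y" "R y x" for x y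
      using that le_rstar_antisym unfolding R invariant_order_def by (metis star_star)
    have B': "invariant_order T c (star b)" if "c \<in> star ` B" for c
      using B that unfolding R by blast
    have img: "rp ` star ` B = lp ` B" by (simp add: image_image lp_eq_rp_star)
    have S: "lp ` B \<subseteq> projections" by auto
    \<comment> \<open>The bounds found below \<open>star b\<close> have the form
      \<open>star b * p\<close>; applying \<open>star\<close> puts the projection on the left of
      \<open>b\<close>.\<close>
    have eq: "star (star b * p) = p * b" if "p \<in> projections" for p
      using projectionsD(1)[OF that] by (simp add: star_mult)
    have l: "least (ring_order R) (proj_Sup (lp ` B) * b) (Upper (ring_order R) B)"
      using bounds_star_transport(1)[OF invariant_order_least[of T "star ` B" "star b", OF T B']]
      unfolding R img eq[OF proj_Sup_in_projections[OF S]] by simp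
    have g: "greatest (ring_order R) (proj_Inf (lp ` B) * b) (Lower (ring_order R) B)"
      using bounds_star_transport(2)[OF invariant_order_greatest[of T "star ` B" "star b", OF T B']] assms(2)
      unfolding R img eq[OF proj_Inf_in_projections[OF S]] by simp
    show ?thesis
      using l g sup_ring_order_eqI[OF l anti] inf_ring_order_eqI[OF g anti] by blast
  qed
  ultimately show ?thesis using assms(1) by blast
qed

end
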